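(* Let $p_1(n)$ denote the number of partitions of $n$ into parts congruent to $\pm 1, \pm 5, \pm 11, \pm 12 \pmod{30}$, where the parts congruent to $\pm 5, \pm 12 \pmod{30}$ have two colors. Let $p_2(n)$ denote the number of partitions of $n$ into parts congruent to $\pm 5, \pm 6, \pm 7, \pm 13 \pmod{30}$, where the parts congruent to $\pm 5, \pm 6 \pmod{30}$ have two colors. Let $p_3(n)$ denote the number of partitions of $n$ into parts congruent to $\pm 1, \pm 6, \pm 7, \pm 11, \pm 12, \pm 13 \pmod{30}$. Then for each positive integer $n$, \[ p_1(n)-p_2(n)=p_3(n-1). \]
   Context: A partition in which parts from certain residue classes "have two colors" means each such part size may appear in two distinguishable copies (colors), so the generating function for parts $\equiv r \pmod{s}$ with $k$ colors is $\prod_{m\ge0}(1-q^{sm+r})^{-k}$. Here $\pm r \pmod{30}$ means the classes $r$ and $30-r$ modulo $30$; parts are positive integers. By convention $p_i(0)=1$. *)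

theory Defs
  imports "HOL-Library.Multiset"
begin

text \<open>
  A coloured partition is a multiset of pairs (part, colour). The function \<open>k\<close> gives the number of
  colours in which a part of a given size is available, with \<open>k m = 0\<close> meaning that \<open>m\<close> is not
  allowed as a part; the colours of \<open>m\<close> are \<open>0, \<dots>, k m - 1\<close>. The partitions of \<open>0\<close> are exactly the
  empty multiset.
\<close>

definition coloured_partitions :: "(nat \<Rightarrow> nat) \<Rightarrow> nat \<Rightarrow> (nat \<times> nat) multiset set" where
  "coloured_partitions k n =
     {M. (\<forall>(m, c) \<in># M. 0 < m \<and> c < k m) \<and> (\<Sum>(m, c) \<in># M. m) = n}"

definition pm30 :: "nat set \<Rightarrow> nat set" where
  "pm30 R = R \<union> (\<lambda>r. 30 - r) ` R"

text \<open>Parts congruent to \<open>\<plusminus>r\<close> mod 30 for some \<open>r \<in> R\<close>; those with \<open>r \<in> T\<close> have two colours.\<close>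

definition colours :: "nat set \<Rightarrow> nat set \<Rightarrow> nat \<Rightarrow> nat" where
  "colours R T m =
     (if m mod 30 \<in> pm30 R then (if m mod 30 \<in> pm30 T then 2 else 1) else 0)"

definition p1 :: "nat \<Rightarrow> nat" where
  "p1 n = card (coloured_partitions (colours {1, 5, 11, 12} {5, 12}) n)"

definition p2 :: "nat \<Rightarrow> nat" where
  "p2 n = card (coloured_partitions (colours {5, 6, 7, 13} {5, 6}) n)"

definition p3 :: "nat \<Rightarrow> nat" where
  "p3 n = card (coloured_partitions (colours {1, 6, 7, 11, 12, 13} {}) n)"

text \<open>The cardinalities above are those of finite sets.\<close>

lemma finite_coloured_partitions: "finite (coloured_partitions k n)"
proof (rule finite_subset)
  let ?A = "Sigma {0<..n} (\<lambda>m. {..<k m})"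
  show "coloured_partitions k n \<subseteq> (\<Union>i\<le>n. {M. set_mset M \<subseteq> ?A \<and> size M = i})"
  proof
    fix M assume M: "M \<in> coloured_partitions k n"
    have s: "(\<Sum>x \<in># M. fst x) = n"
      using M by (simp add: coloured_partitions_def case_prod_unfold)
    have pos: "0 < fst x \<and> snd x < k (fst x)" if "x \<in># M" for x
      using M that by (auto simp: coloured_partitions_def)
    have "fst x \<le> n" if "x \<in># M" for x
      using s multi_member_split[OF that] by auto
    hence "set_mset M \<subseteq> ?A"
      using pos by fastforce
    moreover have "size M \<le> (\<Sum>x \<in># M. fst x)"
      using pos by (induction M) (fastforce simp: Suc_le_eq)+
    ultimately show "M \<in> (\<Union>i\<le>n. {M. set_mset M \<subseteq> ?A \<and> size M = i})"
      using s by auto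
  qed
  have "finite ?A" by simp
  then show "finite (\<Union>i\<le>n. {M. set_mset M \<subseteq> ?A \<and> size M = i})"
    using finite_multisets_of_size[of ?A] by (simp add: multisets_of_size_def)
qed

lemma coloured_partitions_0: "coloured_partitions k 0 = {{#}}"
proof -
  have "M = {#}" if "M \<in> coloured_partitions k 0" for M
    using that by (cases M) (auto simp: coloured_partitions_def)
  thus ?thesis by (auto simp: coloured_partitions_def)
qed

end

theory Submission
  imports Defs "HOL-Computational_Algebra.Formal_Power_Series"
begin

unbundle fps_syntax

text \<open>
  Write \<open>[a]\<close> for the theta product \<open>(q\<^sup>a, q\<^sup>3\<^sup>0\<^sup>-\<^sup>a; q\<^sup>3\<^sup>0)\<^sub>\<infinity>\<close>. Clearing denominators in the generating functions
  turns the claim into \<open>[6]\<^sup>2[7][13] - [1][11][12]\<^sup>2 = q [5]\<^sup>2[6][12]\<close>, an instance of Weierstrass' three-term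
  relation for theta functions with exponents \<open>(x, y, u, v) = (15, 9, 10, 3)\<close>. By the Jacobi triple product,
  \<open>[x + y][x - y]\<close> is, up to a monomial and a common factor, a \<open>2 \<times> 2\<close> determinant \<open>C(x) E(y) - E(x) C(y)\<close>,
  so the three-term relation is the Pluecker relation for \<open>2 \<times> 2\<close> minors. The triple product is the limit
  of the finite \<open>q\<close>-binomial theorem; all limits are taken coefficientwise.
\<close>

section \<open>Truncated equality and infinite products\<close>

text \<open>Congruence modulo \<open>fps_X ^ Suc N\<close>. Being a ring congruence, it carries
  every passage to the limit.\<close>

definition eq_upto :: "nat \<Rightarrow> 'a::comm_ring_1 fps \<Rightarrow> 'a fps \<Rightarrow> bool" where
  "eq_upto N f g \<longleftrightarrow> (\<forall>n\<le>N. f $ n = g $ n)"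

lemma eq_upto_refl [simp]: "eq_upto N f f"
  by (simp add: eq_upto_def)

lemma eq_upto_sym: "eq_upto N f g \<Longrightarrow> eq_upto N g f"
  by (simp add: eq_upto_def)

lemma eq_upto_trans [trans]: "eq_upto N f g \<Longrightarrow> eq_upto N g h \<Longrightarrow> eq_upto N f h"
  by (simp add: eq_upto_def)

lemma eq_upto_mult: "eq_upto N f g \<Longrightarrow> eq_upto N f' g' \<Longrightarrow> eq_upto N (f * f') (g * g')"
  by (auto simp: eq_upto_def fps_mult_nth intro!: sum.cong)

lemma eq_upto_sum:
  "(\<And>i. i \<in> A \<Longrightarrow> eq_upto N (f i) (g i)) \<Longrightarrow> eq_upto N (\<Sum>i\<in>A. f i) (\<Sum>i\<in>A. g i)"
  by (auto simp: eq_upto_def fps_sum_nth intro!: sum.cong)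

lemma eq_upto_power: "eq_upto N f g \<Longrightarrow> eq_upto N (f ^ k) (g ^ k)"
  by (induction k) (auto intro: eq_upto_mult)

lemma eq_upto_imp_eq: "(\<And>N. eq_upto N f g) \<Longrightarrow> f = g"
  by (auto simp: eq_upto_def fps_eq_iff)

definition euler_part :: "(nat \<Rightarrow> nat) \<Rightarrow> nat \<Rightarrow> int fps" where
  "euler_part e N = (\<Prod>m=1..N. (1 - fps_X ^ m) ^ e m)"

text \<open>The infinite product of (1 - q^m)^(e m) over m >= 1: factors with m > n leave
  coefficient n alone, so the n-th partial product supplies it.\<close>

definition euler_prod :: "(nat \<Rightarrow> nat) \<Rightarrow> int fps" where
  "euler_prod e = Abs_fps (\<lambda>n. euler_part e n $ n)"

lemma eq_upto_euler_part:
  assumes "N \<le> M"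
  shows "eq_upto N (euler_part e M) (euler_part e N)"
  using assms
proof (induction M rule: dec_induct)
  case (step M)
  have "eq_upto N (1 - fps_X ^ Suc M :: int fps) 1"
    using step by (auto simp: eq_upto_def fps_X_power_nth simp del: power_Suc)
  from eq_upto_power[OF this, of "e (Suc M)"] 
  have "eq_upto N ((1 - fps_X ^ Suc M :: int fps) ^ e (Suc M)) 1" by simp
  from eq_upto_mult[OF this step.IH] show ?case
    by (simp add: euler_part_def mult_ac del: power_Suc)
qed simp

lemma eq_upto_euler_prod:
  assumes "N \<le> M"
  shows "eq_upto N (euler_prod e) (euler_part e M)"
  unfolding eq_upto_def
proof safe
  fix n assume "n \<le> N"
  with eq_upto_euler_part[of n M e] assms show "euler_prod e $ n = euler_part e M $ n"
    by (simp add: eq_upto_def euler_prod_def)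
qed

lemma euler_prod_add: "euler_prod (\<lambda>m. e m + f m) = euler_prod e * euler_prod f"
proof (rule eq_upto_imp_eq)
  fix N
  have "eq_upto N (euler_prod e * euler_prod f) (euler_part e N * euler_part f N)"
    by (intro eq_upto_mult eq_upto_euler_prod) auto
  also have "euler_part e N * euler_part f N = euler_part (\<lambda>m. e m + f m) N"
    by (simp add: euler_part_def power_add prod.distrib)
  finally show "eq_upto N (euler_prod (\<lambda>m. e m + f m)) (euler_prod e * euler_prod f)"
    using eq_upto_euler_prod[of N N] eq_upto_trans eq_upto_sym by blast
qed

lemma euler_prod_times2: "euler_prod (\<lambda>m. 2 * e m) = euler_prod e ^ 2"
  using euler_prod_add[of e e] by (simp add: mult_2 power2_eq_square)

lemma euler_prod_nonzero: "euler_prod e \<noteq> 0"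
proof -
  have "euler_prod e $ 0 = 1"
    by (simp add: euler_prod_def euler_part_def)
  thus ?thesis by auto
qed

text \<open>The numbers 1, ..., s * N form N blocks of length s, each with exactly one element of
  the class of a. Writing \<open>a mod s\<close> lets a = s stand for the class of 0, as
  \<open>base_fps\<close> requires.\<close>

lemma euler_part_residue:
  assumes "0 < a" "a \<le> s"
  shows "euler_part (\<lambda>m. of_bool (m mod s = a mod s)) (s * N) = (\<Prod>j<N. 1 - fps_X ^ (s * j + a))"
proof -
  let ?S = "{m \<in> {1..s * N}. m mod s = a mod s}"
  have img: "?S = (\<lambda>j. s * j + a) ` {..<N}"
  proof (intro equalityI subsetI)
    fix m assume m: "m \<in> ?S"
    have am: "a \<le> m"
    proof (cases "a = s")
      case True
      with m have "s dvd m" by auto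
      with m True show ?thesis by (auto dest: dvd_imp_le)
    next
      case False
      with m assms have "m mod s = a" by auto
      thus ?thesis using mod_less_eq_dividend[of m s] by simp
    qed
    with m have "s dvd m - a" by (auto simp: mod_eq_dvd_iff_nat)
    then obtain j where j: "m - a = s * j" ..
    moreover have "m \<le> s * N" using m by simp
    ultimately have "s * j < s * N" using am assms(1) by linarith
    hence "j < N" by simp
    with j am show "m \<in> (\<lambda>j. s * j + a) ` {..<N}" by (auto intro!: image_eqI[of _ _ j])
  next
    fix m assume "m \<in> (\<lambda>j. s * j + a) ` {..<N}"
    then obtain j where j: "j < N" "m = s * j + a" by auto
    have "s * j + a \<le> s * Suc j" using assms by simp
    also have "\<dots> \<le> s * N" using j by (intro mult_le_mono2) auto
    finally show "m \<in> ?S" using j assms by auto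
  qed
  have "euler_part (\<lambda>m. of_bool (m mod s = a mod s)) (s * N)
      = (\<Prod>m\<in>{1..s*N}. if m mod s = a mod s then 1 - fps_X ^ m else 1)"
    unfolding euler_part_def by (intro prod.cong) auto
  also have "\<dots> = (\<Prod>m\<in>?S. 1 - fps_X ^ m)"
    by (rule prod.inter_filter[symmetric]) simp
  also have "\<dots> = (\<Prod>j<N. 1 - fps_X ^ (s * j + a))"
    unfolding img using assms by (subst prod.reindex) (auto simp: inj_on_def)
  finally show ?thesis .
qed

section \<open>Generating functions of coloured partitions\<close>

definition weighted_msets :: "('a \<Rightarrow> nat) \<Rightarrow> 'a set \<Rightarrow> nat \<Rightarrow> 'a multiset set" where
  "weighted_msets w A n = {M. set_mset M \<subseteq> A \<and> (\<Sum>x\<in>#M. w x) = n}"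

lemma size_le_weight:
  assumes "\<forall>x\<in>#M. 0 < w x"
  shows "size M \<le> (\<Sum>x\<in>#M. (w x :: nat))"
  using assms by (induction M) (fastforce simp: Suc_le_eq)+

lemma finite_weighted_msets:
  assumes "finite A" "\<forall>x\<in>A. 0 < w x"
  shows "finite (weighted_msets w A n)"
proof (rule finite_subset)
  show "weighted_msets w A n \<subseteq> (\<Union>i\<le>n. multisets_of_size A i)"
    using assms size_le_weight[of _ w]
    by (auto simp: weighted_msets_def multisets_of_size_def) blast
qed (use assms in auto)

text \<open>Induction on A: a multiset over \<open>insert x A\<close> either avoids x or, after
  removal of one copy of x, is an arbitrary multiset over \<open>insert x A\<close> of weight
  smaller by \<open>w x\<close>. So each new element x divides the generating function by 1 - q^(w
  x).\<close>

lemma gf_weighted_msets: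
  assumes "finite A" "\<forall>x\<in>A. 0 < w x"
  shows "Abs_fps (\<lambda>n. int (card (weighted_msets w A n))) * (\<Prod>x\<in>A. 1 - fps_X ^ w x) = 1"
  using assms
proof (induction A rule: finite_induct)
  case empty
  have "weighted_msets w {} n = (if n = 0 then {{#}} else {})" for n
    by (auto simp: weighted_msets_def)
  thus ?case by (simp add: fps_eq_iff)
next
  case (insert x A)
  let ?G = "\<lambda>A. Abs_fps (\<lambda>n. int (card (weighted_msets w A n)))"
  let ?I = "insert x A"
  have "?G ?I = ?G A + fps_X ^ w x * ?G ?I"
  proof (rule fps_ext)
    fix n
    let ?R = "{M \<in> weighted_msets w ?I n. x \<in># M}"
    have split: "weighted_msets w ?I n = weighted_msets w A n \<union> ?R"
      by (auto simp: weighted_msets_def)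
    have fin: "finite (weighted_msets w ?I n)"
      using insert by (intro finite_weighted_msets) auto
    have "card (weighted_msets w ?I n) = card (weighted_msets w A n) + card ?R"
    proof (subst split, rule card_Un_disjoint)
      show "finite (weighted_msets w A n)" "finite ?R"
        using fin split by (metis finite_Un)+
      show "weighted_msets w A n \<inter> ?R = {}"
        using insert by (auto simp: weighted_msets_def)
    qed
    moreover have "card ?R = (if n < w x then 0 else card (weighted_msets w ?I (n - w x)))"
    proof (cases "n < w x")
      case True
      hence "?R = {}"
        by (auto simp: weighted_msets_def dest!: multi_member_split)
      show ?thesis unfolding \<open>?R = {}\<close> using True by simp
    next
      case False
      have "bij_betw (add_mset x) (weighted_msets w ?I (n - w x)) ?R"
      proof (rule bij_betwI[where g = "\<lambda>M. M - {#x#}"])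
        show "(\<lambda>M. M - {#x#}) \<in> ?R \<rightarrow> weighted_msets w ?I (n - w x)"
          by (auto simp: weighted_msets_def dest!: multi_member_split)
      qed (use False in \<open>auto simp: weighted_msets_def\<close>)
      from bij_betw_same_card[OF this] False show ?thesis by simp
    qed
    ultimately show "?G ?I $ n = (?G A + fps_X ^ w x * ?G ?I) $ n"
      by (simp add: fps_X_power_mult_nth)
  qed
  hence "?G ?I * (1 - fps_X ^ w x) = ?G A"
    by (simp add: algebra_simps)
  with insert show ?case
    by (simp add: mult.assoc[symmetric])
qed

definition gf_coloured :: "(nat \<Rightarrow> nat) \<Rightarrow> int fps" where
  "gf_coloured k = Abs_fps (\<lambda>n. int (card (coloured_partitions k n)))"

lemma gf_coloured_mult_euler_prod: "gf_coloured k * euler_prod k = 1"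
proof (rule eq_upto_imp_eq)
  fix N
  \<comment> \<open>Coefficients up to N involve only parts of size at most N, so the alphabet of
    coloured parts may be cut down to the finite set A.\<close>
  define A where "A = Sigma {1..N} (\<lambda>m. {..<k m})"
  have fst_le: "fst x \<le> (\<Sum>x\<in>#M. fst x)" if "x \<in># M" for x and M :: "(nat \<times> nat) multiset"
    using multi_member_split[OF that] by auto
  have "coloured_partitions k n = weighted_msets fst A n" if "n \<le> N" for n
  proof -
    have "fst x \<le> N" if "(\<Sum>x\<in>#M. fst x) = n" "x \<in># M" for x and M :: "(nat \<times> nat) multiset"
      using fst_le[OF that(2)] that(1) \<open>n \<le> N\<close> by linarith
    thus ?thesis
      by (auto simp: coloured_partitions_def weighted_msets_def A_def case_prod_unfold Suc_le_eq
          subset_iff mem_Times_iff Ball_def)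
  qed
  hence "eq_upto N (gf_coloured k) (Abs_fps (\<lambda>n. int (card (weighted_msets fst A n))))"
    by (simp add: eq_upto_def gf_coloured_def)
  moreover have "(\<Prod>x\<in>A. 1 - fps_X ^ fst x) = euler_part k N"
    using prod.Sigma[of "{1..N}" "\<lambda>m. {..<k m}" "\<lambda>m c. 1 - fps_X ^ m :: int fps"]
    by (simp add: A_def euler_part_def case_prod_unfold)
  hence "eq_upto N (euler_prod k) (\<Prod>x\<in>A. 1 - fps_X ^ fst x)"
    using eq_upto_euler_prod by simp
  ultimately have "eq_upto N (gf_coloured k * euler_prod k)
      (Abs_fps (\<lambda>n. int (card (weighted_msets fst A n))) * (\<Prod>x\<in>A. 1 - fps_X ^ fst x))"
    by (rule eq_upto_mult)
  also have "\<dots> = 1"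
    by (rule gf_weighted_msets) (auto simp: A_def)
  finally show "eq_upto N (gf_coloured k * euler_prod k) 1" .
qed

text \<open>\<open>gf_coloured e\<close> is the inverse of \<open>euler_prod e\<close>, and
  multiplying by it preserves the congruence.\<close>

lemma eq_upto_euler_prod_cancel:
  assumes "eq_upto N (euler_prod e * f) (euler_prod e * g)"
  shows "eq_upto N f g"
  using eq_upto_mult[OF eq_upto_refl[of N "gf_coloured e"] assms]
  by (simp add: mult.assoc[symmetric] gf_coloured_mult_euler_prod)

section \<open>The Jacobi triple product\<close>

fun qbinom :: "'a::comm_ring_1 \<Rightarrow> nat \<Rightarrow> nat \<Rightarrow> 'a" where
  "qbinom q n 0 = 1"
| "qbinom q 0 (Suc k) = 0"
| "qbinom q (Suc n) (Suc k) = qbinom q n k + q ^ Suc k * qbinom q n (Suc k)"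

lemma qbinom_eq_0: "n < k \<Longrightarrow> qbinom q n k = 0"
  by (induction q n k rule: qbinom.induct) auto

text \<open>The homogeneous form in w and x allows centring the product later without negative
  powers of q. The induction needs arbitrary x, because splitting off the factor i = 0 replaces x by
  x * q.\<close>

lemma qbinom_theorem:
  "(\<Prod>i<n. w + x * q ^ i) = (\<Sum>k\<le>n. qbinom q n k * q ^ (k choose 2) * x ^ k * w ^ (n - k))"
proof (induction n arbitrary: x)
  case (Suc n)
  define F where "F = (\<lambda>k. qbinom q n k * q ^ (k choose 2) * (x * q) ^ k * w ^ (n - k))"
  define G where "G = (\<lambda>k. qbinom q n k * q ^ (k choose 2) * (x * q) ^ k * w ^ (Suc n - k))"
  have "(\<Prod>i<Suc n. w + x * q ^ i) = (w + x) * (\<Prod>i<n. w + (x * q) * q ^ i)"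
    by (simp add: prod.lessThan_Suc_shift mult_ac del: prod.lessThan_Suc)
  also have "(\<Prod>i<n. w + (x * q) * q ^ i) = (\<Sum>k\<le>n. F k)"
    unfolding Suc.IH F_def ..
  also have "(w + x) * (\<Sum>k\<le>n. F k) = (\<Sum>k\<le>n. w * F k) + (\<Sum>k\<le>n. x * F k)"
    by (simp only: distrib_right sum_distrib_left sum.distrib)
  also have "(\<Sum>k\<le>n. w * F k) = (\<Sum>k\<le>n. G k)"
    by (intro sum.cong) (auto simp: F_def G_def Suc_diff_le mult_ac)
  \<comment> \<open>The added term k = Suc n vanishes because
    \<open>qbinom q n (Suc n) = 0\<close>.\<close>
  also have "\<dots> = (\<Sum>k\<le>Suc n. G k)"
    by (simp add: G_def qbinom_eq_0)
  also have "\<dots> = G 0 + (\<Sum>k\<le>n. G (Suc k))"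
    by (rule sum.atMost_Suc_shift)
  also have "\<dots> + (\<Sum>k\<le>n. x * F k) = G 0 + (\<Sum>k\<le>n. G (Suc k) + x * F k)"
    by (simp add: sum.distrib)
  also have "\<dots> = (\<Sum>k\<le>Suc n. qbinom q (Suc n) k * q ^ (k choose 2) * x ^ k * w ^ (Suc n - k))"
    unfolding sum.atMost_Suc_shift
  proof (intro arg_cong2[where f = "(+)"] sum.cong refl)
    show "G (Suc k) + x * F k =
      qbinom q (Suc n) (Suc k) * q ^ (Suc k choose 2) * x ^ Suc k * w ^ (Suc n - Suc k)" for k
    proof -
      have "Suc k choose 2 = k + (k choose 2)" by (simp add: numeral_2_eq_2)
      thus ?thesis
        by (simp add: F_def G_def power_mult_distrib power_add algebra_simps)
    qed
  qed (simp add: G_def numeral_2_eq_2)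
  finally show ?case .
qed (simp add: binomial_eq_0)

text \<open>The q-Pochhammer symbol (q; q)_n, that is, the q-factorial without the denominator (1 -
  q)^n.\<close>

definition qfact :: "'a::comm_ring_1 \<Rightarrow> nat \<Rightarrow> 'a" where
  "qfact q n = (\<Prod>i<n. 1 - q ^ Suc i)"

text \<open>The quotient formula with denominators cleared, as it has to hold in any commutative
  ring. The induction step rests on 1 - q^(n+1) = (1 - q^(j+1)) + q^(j+1) (1 - q^(n-j)).\<close>

lemma qbinom_qfact:
  "k \<le> n \<Longrightarrow> qbinom q n k * qfact q k * qfact q (n - k) = qfact q n"
proof (induction n arbitrary: k)
  case (Suc n)
  show ?case
  proof (cases k)
    case (Suc j)
    have s: "qfact q (Suc m) = qfact q m * (1 - q ^ Suc m)" for m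
      by (simp add: qfact_def)
    have IH: "qbinom q n j * qfact q j * qfact q (n - j) = qfact q n"
      using Suc.IH[of j] Suc.prems Suc by simp
    \<comment> \<open>For j = n the induction hypothesis does not apply, but both sides vanish:
      \<open>qbinom q n (Suc n) = 0\<close> and 1 - q^0 = 0.\<close>
    have IH': "qbinom q n (Suc j) * qfact q (Suc j) * qfact q (n - j) =
        (1 - q ^ (n - j)) * qfact q n"
    proof (cases "j = n")
      case False
      with Suc.prems Suc have "n - j = Suc (n - Suc j)" "Suc j \<le> n" by auto
      with Suc.IH[of "Suc j"] have "qbinom q n (Suc j) * qfact q (Suc j) * qfact q (n - Suc j) = qfact q n"
        by simp
      moreover have "qfact q (n - j) = (1 - q ^ (n - j)) * qfact q (n - Suc j)"
        unfolding \<open>n - j = Suc (n - Suc j)\<close> by (simp add: s mult.commute)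
      ultimately show ?thesis by (metis mult.assoc mult.left_commute)
    qed (simp add: qbinom_eq_0)
    have "Suc n = Suc j + (n - j)"
      using Suc Suc.prems by simp
    hence "q ^ Suc n = q ^ Suc j * q ^ (n - j)"
      by (metis power_add)
    have "qbinom q (Suc n) (Suc j) * qfact q (Suc j) * qfact q (n - j) =
        (1 - q ^ Suc j) * (qbinom q n j * qfact q j * qfact q (n - j))
        + q ^ Suc j * (qbinom q n (Suc j) * qfact q (Suc j) * qfact q (n - j))"
      by (simp add: s algebra_simps)
    also have "\<dots> = qfact q n * (1 - q ^ Suc j * q ^ (n - j))"
      unfolding IH IH' by (simp add: algebra_simps)
    also have "\<dots> = qfact q (Suc n)"
      unfolding s \<open>q ^ Suc n = _\<close> ..
    finally show ?thesis by (simp add: Suc)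
  qed (simp add: qfact_def)
qed (simp add: qfact_def)

text \<open>\<open>base_fps h\<close> and \<open>theta_fps h a\<close> are \<open>(q\<^sup>2\<^sup>h; q\<^sup>2\<^sup>h)\<^sub>\<infinity>\<close> and \<open>(q\<^sup>a, q\<^sup>2\<^sup>h\<^sup>-\<^sup>a; q\<^sup>2\<^sup>h)\<^sub>\<infinity>\<close>; the even
  modulus keeps the exponents of the triple product series free of division.\<close>

definition base_fps :: "nat \<Rightarrow> int fps" where
  "base_fps h = euler_prod (\<lambda>m. of_bool (m mod (2 * h) = 0))"

text \<open>A sum instead of a disjunction: for a = h the two residue classes coincide and must
  count twice.\<close>

definition theta_exp :: "nat \<Rightarrow> nat \<Rightarrow> nat \<Rightarrow> nat" where
  "theta_exp h a m = of_bool (m mod (2 * h) = a) + of_bool (m mod (2 * h) = 2 * h - a)"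

definition theta_fps :: "nat \<Rightarrow> nat \<Rightarrow> int fps" where
  "theta_fps h a = euler_prod (theta_exp h a)"

definition theta_part :: "nat \<Rightarrow> nat \<Rightarrow> nat \<Rightarrow> int fps" where
  "theta_part h a N =
     (\<Prod>j<N. 1 - fps_X ^ (2 * h * j + a)) * (\<Prod>j<N. 1 - fps_X ^ (2 * h * j + (2 * h - a)))"

lemma eq_upto_theta:
  assumes "0 < a" "a < 2 * h" "M \<le> N"
  shows "eq_upto M (theta_fps h a) (theta_part h a N)"
proof -
  have "euler_part (theta_exp h a) (2 * h * N) = theta_part h a N"
    using euler_part_residue[of a "2 * h" N] euler_part_residue[of "2 * h - a" "2 * h" N] assms
    unfolding theta_part_def theta_exp_def
    by (simp add: euler_part_def power_add prod.distrib)
  moreover have "M \<le> 2 * h * N"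
    using assms by (cases h) auto
  ultimately show ?thesis
    using eq_upto_euler_prod[of M "2 * h * N" "theta_exp h a"] by (simp add: theta_fps_def)
qed

lemma eq_upto_base:
  assumes "0 < h" "M \<le> N"
  shows "eq_upto M (base_fps h) (qfact (fps_X ^ (2 * h)) N)"
proof -
  have "(fps_X ^ (2 * h)) ^ Suc j = (fps_X ^ (2 * h * j + 2 * h) :: int fps)" for j
    unfolding power_mult[symmetric] by (simp add: add.commute)
  hence "euler_part (\<lambda>m. of_bool (m mod (2 * h) = 0)) (2 * h * N) = qfact (fps_X ^ (2 * h)) N"
    using euler_part_residue[of "2 * h" "2 * h" N] assms
    by (simp add: qfact_def del: power_Suc)
  moreover have "M \<le> 2 * h * N"
    using assms by (cases h) auto
  ultimately show ?thesis
    using eq_upto_euler_prod[of M "2 * h * N" "\<lambda>m. of_bool (m mod (2 * h) = 0)"]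
    by (simp add: base_fps_def)
qed

text \<open>In \<open>qbinom_qfact\<close> the indices k, n - k and n are all at least M, so each of
  the three \<open>qfact\<close> factors agrees with \<open>base_fps h\<close> up to M; one copy
  cancels.\<close>

lemma eq_upto_qbinom_base:
  assumes "0 < h" "M \<le> k" "M + k \<le> n"
  shows "eq_upto M (qbinom (fps_X ^ (2 * h)) n k * base_fps h) 1"
proof -
  let ?b = "qbinom (fps_X ^ (2 * h)) n k :: int fps" and ?f = "qfact (fps_X ^ (2 * h)) :: nat \<Rightarrow> int fps"
  have "eq_upto M (?b * base_fps h * base_fps h) (?b * ?f k * ?f (n - k))"
    using assms by (intro eq_upto_mult eq_upto_base) auto
  also have "?b * ?f k * ?f (n - k) = ?f n"
    using assms by (intro qbinom_qfact) auto
  also have "eq_upto M (?f n) (base_fps h)"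
    using assms by (intro eq_upto_sym[OF eq_upto_base]) auto
  finally have "eq_upto M (base_fps h * (?b * base_fps h)) (base_fps h * 1)"
    by (simp add: mult_ac)
  thus ?thesis
    unfolding base_fps_def by (rule eq_upto_euler_prod_cancel)
qed

definition jtp_exp :: "nat \<Rightarrow> nat \<Rightarrow> int \<Rightarrow> int" where
  "jtp_exp h a l = int h * l * (l - 1) + int a * l"

text \<open>This growth bound yields nonnegative exponents, finite fibres and the truncation
  estimate. Negative l reduce to positive ones, since l -> -l exchanges a and 2 * h - a.\<close>

lemma abs_le_jtp_exp:
  assumes "0 < a" "a < 2 * h"
  shows "\<bar>l\<bar> \<le> jtp_exp h a l"
proof (cases "l \<ge> 1")
  case True
  have "0 \<le> int h * (l * (l - 1))" using True by simp
  moreover have "1 * l \<le> int a * l" using True assms by (intro mult_right_mono) auto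
  ultimately show ?thesis using True unfolding jtp_exp_def mult.assoc by linarith
next
  case False
  define m where "m = - l"
  have "0 \<le> m" using False by (simp add: m_def)
  hence "m * (m - 1) \<ge> 0" by (cases "m = 0") auto
  hence "0 \<le> int h * (m * (m - 1))" by simp
  moreover have "0 \<le> (2 * int h - int a - 1) * m"
    using False assms by (intro mult_nonneg_nonneg) (auto simp: m_def)
  ultimately have "m \<le> jtp_exp h a l"
    by (simp add: jtp_exp_def m_def algebra_simps)
  thus ?thesis using False by (simp add: m_def)
qed

text \<open>The q-binomial theorem with 2 * N factors, w = q^N and x = -fps_X^a. Taking the smaller
  power out of each factor, the first N factors give the product for 2 * h - a in reverse order, and
  the last N give the product for a.\<close>

lemma finite_jtp:
  assumes "0 < a" "a < 2 * h"
  shows "theta_part h a N =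
    (\<Sum>k\<le>2*N. (-1) ^ (k + N) * fps_X ^ nat (jtp_exp h a (int k - int N)) *
       qbinom (fps_X ^ (2 * h)) (2 * N) k)"
proof -
  define q :: "int fps" where "q = fps_X ^ (2 * h)"
  define w :: "int fps" where "w = q ^ N"
  define x :: "int fps" where "x = - (fps_X ^ a)"
  \<comment> \<open>The total exponent taken out: a * N + h * N * (N - 1) from the first N factors,
    2 * h * N^2 from the others.\<close>
  define E where "E = a * N + h * (N * (N - 1)) + 2 * h * N * N"
  have ch: "2 * h * (k choose 2) = h * (k * (k - 1))" for k
  proof -
    have "even (k * (k - 1))" by (cases k) auto
    thus ?thesis by (auto simp: choose_two)
  qed
  have qch: "q ^ (k choose 2) = fps_X ^ (h * (k * (k - 1)))" for k
    unfolding q_def power_mult[symmetric] ch ..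
  have low: "(\<Prod>i<N. w + x * q ^ i) =
      (-1) ^ N * fps_X ^ (a * N + h * (N * (N - 1))) * (\<Prod>j<N. 1 - fps_X ^ (2 * h * j + (2 * h - a)))"
  proof -
    have "(\<Prod>i<N. w + x * q ^ i) =
        (\<Prod>i<N. (x * q ^ i) * (1 - fps_X ^ (2 * h * (N - Suc i) + (2 * h - a))))"
    proof (rule prod.cong)
      fix i assume "i \<in> {..<N}"
      then obtain d where d: "N = Suc (i + d)" by (auto simp: less_iff_Suc_add)
      have "a + (2 * h * i + (2 * h * d + (2 * h - a))) = 2 * h * N"
        using assms d by (simp add: algebra_simps)
      hence "fps_X ^ a * q ^ i * fps_X ^ (2 * h * d + (2 * h - a)) = w"
        unfolding w_def q_def power_mult[symmetric] power_add[symmetric] by (simp add: add_ac)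
      thus "w + x * q ^ i = x * q ^ i * (1 - fps_X ^ (2 * h * (N - Suc i) + (2 * h - a)))"
        using d by (simp add: x_def algebra_simps)
    qed simp
    also have "\<dots> = (\<Prod>i<N. x * q ^ i) * (\<Prod>i<N. 1 - fps_X ^ (2 * h * (N - Suc i) + (2 * h - a)))"
      by (rule prod.distrib)
    also have "(\<Prod>i<N. 1 - fps_X ^ (2 * h * (N - Suc i) + (2 * h - a)) :: int fps) =
        (\<Prod>j<N. 1 - fps_X ^ (2 * h * j + (2 * h - a)))"
      by (rule prod.nat_diff_reindex)
    also have "(\<Prod>i<N. x * q ^ i) = x ^ N * q ^ (N choose 2)"
      by (induction N) (simp_all add: numeral_2_eq_2 power_add mult_ac)
    also have "\<dots> = (-1) ^ N * fps_X ^ (a * N + h * (N * (N - 1)))"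
      unfolding qch by (simp add: x_def power_minus[of "_ ^ _"] power_add flip: power_mult)
    finally show ?thesis .
  qed
  have high: "(\<Prod>i<N. w + x * q ^ (N + i)) =
      fps_X ^ (2 * h * N * N) * (\<Prod>j<N. 1 - fps_X ^ (2 * h * j + a))"
  proof -
    have "(\<Prod>i<N. w + x * q ^ (N + i)) = (\<Prod>i<N. w * (1 - fps_X ^ (2 * h * i + a)))"
      by (intro prod.cong) (simp_all add: w_def x_def q_def power_add algebra_simps flip: power_mult)
    also have "\<dots> = w ^ N * (\<Prod>i<N. 1 - fps_X ^ (2 * h * i + a))"
      by (simp add: prod.distrib)
    also have "w ^ N = fps_X ^ (2 * h * N * N)"
      by (simp add: w_def q_def flip: power_mult)
    finally show ?thesis .
  qed
  have "(\<Prod>i<2*N. w + x * q ^ i) = (\<Prod>i<N. w + x * q ^ i) * (\<Prod>i<N. w + x * q ^ (N + i))"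
  proof -
    have "(\<Prod>i<N + K. w + x * q ^ i) = (\<Prod>i<N. w + x * q ^ i) * (\<Prod>i<K. w + x * q ^ (N + i))" for K
      by (induction K) (simp_all add: mult.assoc)
    thus ?thesis by (simp add: mult_2)
  qed
  also have "\<dots> = fps_X ^ E * ((-1) ^ N * theta_part h a N)"
  proof -
    have "fps_X ^ E = fps_X ^ (a * N + h * (N * (N - 1))) * (fps_X ^ (2 * h * N * N) :: int fps)"
      unfolding E_def by (rule power_add)
    thus ?thesis unfolding low high theta_part_def by (simp only: mult_ac)
  qed
  finally have "fps_X ^ E * ((-1) ^ N * theta_part h a N) = (\<Prod>i<2*N. w + x * q ^ i)" ..
  also have "\<dots> = (\<Sum>k\<le>2*N. qbinom q (2*N) k * q ^ (k choose 2) * x ^ k * w ^ (2 * N - k))"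
    by (rule qbinom_theorem)
  also have "\<dots> = (\<Sum>k\<le>2*N. fps_X ^ E * ((-1) ^ k * fps_X ^ nat (jtp_exp h a (int k - int N)) *
       qbinom q (2 * N) k))"
  proof (rule sum.cong)
    fix k assume k: "k \<in> {..2*N}"
    have "0 \<le> jtp_exp h a (int k - int N)"
      using abs_le_jtp_exp[OF assms, of "int k - int N"] by linarith
    \<comment> \<open>The exponents are compared in \<open>int\<close>, because k - N may be
      negative.\<close>
    moreover have "int (h * (k * (k - 1)) + a * k + 2 * h * N * (2 * N - k)) =
      int E + jtp_exp h a (int k - int N)"
    proof -
      have "int (m * (m - 1)) = int m * (int m - 1)" for m by (cases m) (simp_all add: algebra_simps)
      thus ?thesis using k
        unfolding E_def jtp_exp_def of_nat_add of_nat_mult[of h] of_nat_mult[of a] of_nat_mult[of _ "2*N-k"]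
        by (simp add: of_nat_diff algebra_simps)
    qed
    ultimately have "h * (k * (k - 1)) + a * k + 2 * h * N * (2 * N - k) =
       E + nat (jtp_exp h a (int k - int N))"
      by linarith
    moreover have "q ^ (k choose 2) * x ^ k * w ^ (2 * N - k) =
        (-1) ^ k * fps_X ^ (h * (k * (k - 1)) + a * k + 2 * h * N * (2 * N - k))"
      unfolding qch unfolding w_def q_def x_def
      by (simp add: power_minus[of "_ ^ _"] power_add mult_ac flip: power_mult)
    ultimately show "qbinom q (2*N) k * q ^ (k choose 2) * x ^ k * w ^ (2 * N - k) =
      fps_X ^ E * ((-1) ^ k * fps_X ^ nat (jtp_exp h a (int k - int N)) * qbinom q (2 * N) k)"
      by (simp add: power_add mult_ac)
  qed simp
  also have "\<dots> = fps_X ^ E * (\<Sum>k\<le>2*N. (-1) ^ k * fps_X ^ nat (jtp_exp h a (int k - int N)) *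
       qbinom q (2 * N) k)"
    by (simp add: sum_distrib_left)
  finally have "(-1) ^ N * theta_part h a N = (\<Sum>k\<le>2*N. (-1) ^ k *
      fps_X ^ nat (jtp_exp h a (int k - int N)) * qbinom q (2 * N) k)"
    by simp
  moreover have "theta_part h a N = (-1) ^ N * ((-1) ^ N * theta_part h a N)"
    by (simp add: mult.assoc[symmetric] power_mult_distrib[symmetric])
  ultimately have "theta_part h a N = (-1) ^ N * (\<Sum>k\<le>2*N. (-1) ^ k *
      fps_X ^ nat (jtp_exp h a (int k - int N)) * qbinom q (2 * N) k)"
    by simp
  thus ?thesis
    by (simp add: q_def sum_distrib_left power_add mult_ac)
qed

text \<open>\<open>gsum A s f\<close> is \<open>\<Sum>i\<in>A. s i * q ^ f i\<close>. If \<open>f\<close> has infinite fibres, the coefficients are junk (the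
  library's value \<open>0\<close> for infinite sums), and negative exponents are dropped; \<open>admissible\<close> excludes both.\<close>

definition gsum :: "'i set \<Rightarrow> ('i \<Rightarrow> int) \<Rightarrow> ('i \<Rightarrow> int) \<Rightarrow> int fps" where
  "gsum A s f = Abs_fps (\<lambda>n. \<Sum>i | i \<in> A \<and> f i = int n. s i)"

definition admissible :: "'i set \<Rightarrow> ('i \<Rightarrow> int) \<Rightarrow> bool" where
  "admissible A f \<longleftrightarrow> (\<forall>i\<in>A. 0 \<le> f i) \<and> (\<forall>n. finite {i \<in> A. f i = int n})"

lemma gsum_truncate:
  assumes "finite B" "B \<subseteq> A" "\<forall>i\<in>B. 0 \<le> f i" "\<forall>i\<in>A - B. int N < f i"
  shows "eq_upto N (gsum A s f) (\<Sum>i\<in>B. of_int (s i) * fps_X ^ nat (f i))"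
  unfolding eq_upto_def
proof safe
  fix n assume n: "n \<le> N"
  have "{i. i \<in> A \<and> f i = int n} = {i \<in> B. nat (f i) = n}"
    using assms n by force
  hence "gsum A s f $ n = (\<Sum>i\<in>B. if nat (f i) = n then s i else 0)"
    using assms(1) by (simp add: gsum_def sum.inter_filter)
  also have "\<dots> = (\<Sum>i\<in>B. of_int (s i) * fps_X ^ nat (f i)) $ n"
    unfolding fps_sum_nth
    by (intro sum.cong) (auto simp: fps_X_power_nth fps_mult_of_int_nth)
  finally show "gsum A s f $ n = (\<Sum>i\<in>B. of_int (s i) * fps_X ^ nat (f i)) $ n" .
qed

definition alt_sign :: "int \<Rightarrow> int" where
  "alt_sign l = (if even l then 1 else -1)"

theorem jacobi_triple_product:
  assumes "0 < a" "a < 2 * h"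
  shows "theta_fps h a * base_fps h = gsum UNIV alt_sign (jtp_exp h a)"
proof (rule eq_upto_imp_eq)
  fix M :: nat
  \<comment> \<open>A term with exponent at most M has |k - N| <= M. With N = 2 * M this gives M <=
    k and M + k <= 2 * N, as \<open>eq_upto_qbinom_base\<close> demands. In all other terms the
    monomial alone vanishes up to M.\<close>
  define N where "N = 2 * M"
  let ?e = "\<lambda>k. jtp_exp h a (int k - int N)"
  have e: "\<bar>int k - int N\<bar> \<le> ?e k" for k
    using abs_le_jtp_exp[OF assms] .
  have "eq_upto M (theta_fps h a * base_fps h) (theta_part h a N * base_fps h)"
    using assms by (intro eq_upto_mult eq_upto_theta) (auto simp: N_def)
  also have "theta_part h a N * base_fps h = (\<Sum>k\<le>2*N. (-1) ^ (k + N) * fps_X ^ nat (?e k) *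
       (qbinom (fps_X ^ (2 * h)) (2 * N) k * base_fps h))"
    by (simp add: finite_jtp[OF assms] sum_distrib_right mult.assoc)
  also have "eq_upto M \<dots> (\<Sum>k\<le>2*N. (-1) ^ (k + N) * fps_X ^ nat (?e k) * 1)"
  proof (rule eq_upto_sum)
    fix k
    show "eq_upto M ((-1) ^ (k + N) * fps_X ^ nat (?e k) *
        (qbinom (fps_X ^ (2 * h)) (2 * N) k * base_fps h)) ((-1) ^ (k + N) * fps_X ^ nat (?e k) * 1)"
    proof (cases "?e k \<le> int M")
      case True
      with e[of k] have "M \<le> k" "M + k \<le> 2 * N" by (auto simp: N_def)
      thus ?thesis using assms by (intro eq_upto_mult eq_upto_qbinom_base) auto
    next
      case False
      hence X: "eq_upto M (fps_X ^ nat (?e k)) (0 :: int fps)"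
        by (auto simp: eq_upto_def fps_X_power_nth)
      have zero: "eq_upto M ((-1) ^ (k + N) * fps_X ^ nat (?e k) * f) (0 :: int fps)" for f
        using eq_upto_mult[OF eq_upto_mult[OF eq_upto_refl[of M "(-1) ^ (k + N) :: int fps"] X] eq_upto_refl[of M f]]
        by simp
      show ?thesis
        by (rule eq_upto_trans[OF zero eq_upto_sym[OF zero]])
    qed
  qed
  also have "(\<Sum>k\<le>2*N. (-1) ^ (k + N) * fps_X ^ nat (?e k) * 1) =
      (\<Sum>l\<in>{- int N..int N}. of_int (alt_sign l) * fps_X ^ nat (jtp_exp h a l) :: int fps)"
    by (rule sum.reindex_bij_witness[of _ "\<lambda>l. nat (l + int N)" "\<lambda>k. int k - int N"])
       (auto simp: alt_sign_def uminus_power_if)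
  also have "eq_upto M \<dots> (gsum UNIV alt_sign (jtp_exp h a))"
  proof (rule eq_upto_sym[OF gsum_truncate])
    show "\<forall>l\<in>{- int N..int N}. 0 \<le> jtp_exp h a l"
      using abs_le_jtp_exp[OF assms] by (meson abs_ge_zero order_trans)
    show "\<forall>l\<in>UNIV - {- int N..int N}. int M < jtp_exp h a l"
    proof
      fix l assume "l \<in> UNIV - {- int N..int N}"
      with abs_le_jtp_exp[OF assms, of l] show "int M < jtp_exp h a l"
        by (auto simp: N_def)
    qed
  qed auto
  finally show "eq_upto M (theta_fps h a * base_fps h) (gsum UNIV alt_sign (jtp_exp h a))" .
qed

section \<open>The three-term relation\<close>

lemma gsum_mult:
  assumes "admissible A f" "admissible B g"
  shows "gsum A s f * gsum B t g = gsum (A \<times> B) (\<lambda>(i, j). s i * t j) (\<lambda>(i, j). f i + g j)"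
proof (rule fps_ext)
  fix n
  let ?F = "\<lambda>a. {i \<in> A. f i = int a}" and ?G = "\<lambda>b. {j \<in> B. g j = int b}"
  have fin: "finite (?F a)" "finite (?G a)" for a
    using assms by (auto simp: admissible_def)
  \<comment> \<open>Nonnegative exponents confine a to 0..n, so the fibre of the sum is a finite
    disjoint union of products of fibres, as in the Cauchy product.\<close>
  have "{p \<in> A \<times> B. (case p of (i, j) \<Rightarrow> f i + g j) = int n} = (\<Union>a\<in>{0..n}. ?F a \<times> ?G (n - a))"
  proof (intro equalityI subsetI)
    fix p assume p: "p \<in> {p \<in> A \<times> B. (case p of (i, j) \<Rightarrow> f i + g j) = int n}"
    hence "0 \<le> f (fst p)" "0 \<le> g (snd p)" using assms by (auto simp: admissible_def)
    with p show "p \<in> (\<Union>a\<in>{0..n}. ?F a \<times> ?G (n - a))"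
      by (intro UN_I[of "nat (f (fst p))"]) (auto simp: of_nat_diff)
  qed auto
  hence "gsum (A \<times> B) (\<lambda>(i, j). s i * t j) (\<lambda>(i, j). f i + g j) $ n =
      (\<Sum>p\<in>(\<Union>a\<in>{0..n}. ?F a \<times> ?G (n - a)). case p of (i, j) \<Rightarrow> s i * t j)"
    by (simp add: gsum_def)
  also have "\<dots> = (\<Sum>a=0..n. \<Sum>p\<in>?F a \<times> ?G (n - a). case p of (i, j) \<Rightarrow> s i * t j)"
    by (intro sum.UNION_disjoint ballI impI finite_cartesian_product fin) auto
  also have "\<dots> = (gsum A s f * gsum B t g) $ n"
    by (simp add: gsum_def fps_mult_nth sum_product sum.cartesian_product)
  finally show "(gsum A s f * gsum B t g) $ n =
    gsum (A \<times> B) (\<lambda>(i, j). s i * t j) (\<lambda>(i, j). f i + g j) $ n" ..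
qed

text \<open>Nonnegativity matters: a term dropped for its negative exponent could reappear after the
  shift.\<close>

lemma X_power_mult_gsum:
  assumes "\<forall>i\<in>A. 0 \<le> f i"
  shows "fps_X ^ c * gsum A s f = gsum A s (\<lambda>i. f i + int c)"
proof (rule fps_ext)
  fix n
  have "{i \<in> A. f i + int c = int n} = (if n < c then {} else {i \<in> A. f i = int (n - c)})"
    using assms by force
  thus "(fps_X ^ c * gsum A s f) $ n = gsum A s (\<lambda>i. f i + int c) $ n"
    by (simp add: gsum_def fps_X_power_mult_nth)
qed

lemma gsum_reindex:
  assumes "inj_on r A" "\<And>i. i \<in> A \<Longrightarrow> s (r i) = s' i" "\<And>i. i \<in> A \<Longrightarrow> f (r i) = f' i"
  shows "gsum (r ` A) s f = gsum A s' f'"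
proof (rule fps_ext)
  fix n
  have "{i \<in> r ` A. f i = int n} = r ` {i \<in> A. f' i = int n}"
    using assms by auto
  moreover have "inj_on r {i \<in> A. f' i = int n}"
    using assms(1) by (rule inj_on_subset) auto
  ultimately show "gsum (r ` A) s f $ n = gsum A s' f' $ n"
    using assms(2) by (simp add: gsum_def sum.reindex)
qed

lemma gsum_Un_disjoint:
  assumes "admissible (A \<union> B) f" "A \<inter> B = {}"
  shows "gsum (A \<union> B) s f = gsum A s f + gsum B s f"
proof (rule fps_ext)
  fix n
  have "{i \<in> A \<union> B. f i = int n} = {i \<in> A. f i = int n} \<union> {i \<in> B. f i = int n}" by auto
  moreover have "finite {i \<in> A \<union> B. f i = int n}"
    using assms by (simp add: admissible_def)
  ultimately show "gsum (A \<union> B) s f $ n = (gsum A s f + gsum B s f) $ n"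
    using assms(2) by (auto simp: gsum_def intro!: sum.union_disjoint)
qed

lemma gsum_uminus: "gsum A (\<lambda>i. - s i) f = - gsum A s f"
  by (simp add: gsum_def fps_eq_iff sum_negf)

lemma admissible_abs:
  assumes "\<And>i. \<bar>i\<bar> \<le> f i + c"  "\<And>i. 0 \<le> f i"
  shows "admissible (A :: int set) f"
proof -
  have "finite {i \<in> A. f i = int n}" for n
  proof (rule finite_subset)
    show "{i \<in> A. f i = int n} \<subseteq> {- (int n + c)..int n + c}"
    proof
      fix i assume "i \<in> {i \<in> A. f i = int n}"
      with assms(1)[of i] show "i \<in> {- (int n + c)..int n + c}" by auto
    qed
  qed simp
  with assms show ?thesis by (simp add: admissible_def)
qed

lemma admissible_Times:
  assumes "admissible A f" "admissible B g"
  shows "admissible (A \<times> B) (\<lambda>(i, j). f i + g j)"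
proof -
  have "finite {p \<in> A \<times> B. (case p of (i, j) \<Rightarrow> f i + g j) = int n}" for n
  proof (rule finite_subset)
    show "{p \<in> A \<times> B. (case p of (i, j) \<Rightarrow> f i + g j) = int n} \<subseteq>
      (\<Union>a\<le>n. {i \<in> A. f i = int a}) \<times> (\<Union>b\<le>n. {j \<in> B. g j = int b})"
    proof
      fix p assume p: "p \<in> {p \<in> A \<times> B. (case p of (i, j) \<Rightarrow> f i + g j) = int n}"
      with assms have "0 \<le> f (fst p)" "0 \<le> g (snd p)" by (auto simp: admissible_def)
      with p have "fst p \<in> (\<Union>a\<le>n. {i \<in> A. f i = int a})" "snd p \<in> (\<Union>b\<le>n. {j \<in> B. g j = int b})"
        by (auto intro: bexI[of _ "nat (f (fst p))"] bexI[of _ "nat (g (snd p))"])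
      thus "p \<in> (\<Union>a\<le>n. {i \<in> A. f i = int a}) \<times> (\<Union>b\<le>n. {j \<in> B. g j = int b})"
        by (simp add: mem_Times_iff)
    qed
  qed (use assms in \<open>auto simp: admissible_def\<close>)
  with assms show ?thesis by (auto simp: admissible_def)
qed

section \<open>Even and odd theta series and the product of two theta functions\<close>

definition even_exp :: "nat \<Rightarrow> nat \<Rightarrow> int \<Rightarrow> int" where
  "even_exp h x j = 2 * int h * j\<^sup>2 + 2 * int x * j"

text \<open>\<open>even_exp\<close> and \<open>odd_exp\<close> are h k^2 / 2 + x k at k = 2 * j and
  at k = 2 * j + 1, the latter raised by h / 2 to make it an integer.\<close>

definition odd_exp :: "nat \<Rightarrow> nat \<Rightarrow> int \<Rightarrow> int" where
  "odd_exp h x j = 2 * int h * (j * (j + 1)) + int h + int x * (2 * j + 1)"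

definition even_theta :: "nat \<Rightarrow> nat \<Rightarrow> int fps" where
  "even_theta h x = gsum UNIV (\<lambda>_. 1) (even_exp h x)"

definition odd_theta :: "nat \<Rightarrow> nat \<Rightarrow> int fps" where
  "odd_theta h x = gsum UNIV (\<lambda>_. 1) (odd_exp h x)"

lemma abs_le_mult_square:
  assumes "0 < h"
  shows "\<bar>m\<bar> \<le> 2 * int h * m\<^sup>2"
proof -
  have "\<bar>m\<bar> \<le> m\<^sup>2"
  proof (cases "m = 0")
    case False
    hence "1 * \<bar>m\<bar> \<le> \<bar>m\<bar> * \<bar>m\<bar>"
      by (intro mult_right_mono) auto
    thus ?thesis by (simp add: power2_eq_square)
  qed simp
  hence "\<bar>m\<bar> \<le> 1 * m\<^sup>2" by simp
  also have "1 * m\<^sup>2 \<le> 2 * int h * m\<^sup>2"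
    using assms by (intro mult_right_mono) auto
  finally show ?thesis .
qed

text \<open>The slack 1 is attained at x = h, j = -1, where the exponent is 0. The boundary case x =
  h is the one that modulus 30 uses.\<close>

lemma abs_le_even_exp:
  assumes "0 < h" "x \<le> h"
  shows "\<bar>j\<bar> \<le> even_exp h x j + 1" "0 \<le> even_exp h x j"
proof -
  have "\<bar>j\<bar> \<le> even_exp h x j + 1 \<and> 0 \<le> even_exp h x j"
  proof (cases "j \<ge> 0")
    case True
    hence "0 \<le> 2 * int x * j" by simp
    with abs_le_mult_square[OF assms(1), of j] True show ?thesis
      unfolding even_exp_def by (intro conjI; linarith)
  next
    case False
    \<comment> \<open>The reflection j = -1 - m writes the exponent as a sum of terms that are
      nonnegative for x <= h.\<close>
    define m where "m = - 1 - j"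
    have m: "0 \<le> m" using False by (simp add: m_def)
    have "even_exp h x j = 2 * ((int h - int x) * (m + 1)) + (2 * int h * m\<^sup>2 + 2 * int h * m)"
      by (simp add: even_exp_def m_def power2_eq_square algebra_simps)
    moreover have "0 \<le> (int h - int x) * (m + 1)" "0 \<le> 2 * int h * m"
      using assms m by auto
    moreover have "\<bar>j\<bar> = m + 1" using False by (simp add: m_def)
    ultimately show ?thesis
      using abs_le_mult_square[OF assms(1), of m] m by (intro conjI; linarith)
  qed
  thus "\<bar>j\<bar> \<le> even_exp h x j + 1" "0 \<le> even_exp h x j" by auto
qed

lemma abs_le_odd_exp:
  assumes "0 < h" "x \<le> h"
  shows "\<bar>j\<bar> \<le> odd_exp h x j + 1" "0 \<le> odd_exp h x j"
proof -
  have "\<bar>j\<bar> \<le> odd_exp h x j + 1 \<and> 0 \<le> odd_exp h x j"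
  proof (cases "j \<ge> 0")
    case True
    hence "0 \<le> 2 * int h * j" "0 \<le> int x * (2 * j + 1)" by auto
    moreover have "odd_exp h x j = 2 * int h * j\<^sup>2 + 2 * int h * j + int h + int x * (2 * j + 1)"
      by (simp add: odd_exp_def power2_eq_square algebra_simps)
    ultimately show ?thesis
      using abs_le_mult_square[OF assms(1), of j] True by (intro conjI; linarith)
  next
    case False
    define m where "m = - 1 - j"
    have m: "0 \<le> m" using False by (simp add: m_def)
    have "odd_exp h x j = (int h - int x) * (2 * m + 1) + 2 * int h * m\<^sup>2"
      by (simp add: odd_exp_def m_def power2_eq_square algebra_simps)
    moreover have "0 \<le> (int h - int x) * (2 * m + 1)"
      using assms m by auto
    moreover have "\<bar>j\<bar> = m + 1" using False by (simp add: m_def)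
    ultimately show ?thesis
      using abs_le_mult_square[OF assms(1), of m] m by (intro conjI; linarith)
  qed
  thus "\<bar>j\<bar> \<le> odd_exp h x j + 1" "0 \<le> odd_exp h x j" by auto
qed

lemma admissible_even_exp: "0 < h \<Longrightarrow> x \<le> h \<Longrightarrow> admissible UNIV (even_exp h x)"
  by (rule admissible_abs[where c = 1, OF abs_le_even_exp])

lemma admissible_odd_exp: "0 < h \<Longrightarrow> x \<le> h \<Longrightarrow> admissible UNIV (odd_exp h x)"
  by (rule admissible_abs[where c = 1, OF abs_le_odd_exp])

text \<open>In the double series for the left-hand side, the indices are \<open>m\<close> and \<open>n\<close>. Passing to \<open>m + n\<close> and
  \<open>m - n\<close>, which have the same parity, separates \<open>x\<close> from \<open>y\<close>.\<close>

lemma theta_mult_theta: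
  assumes "y < x" "x \<le> h"
  shows "fps_X ^ (h - x) * (theta_fps h (x + y) * base_fps h) * (theta_fps h (x - y) * base_fps h)
    = odd_theta h x * even_theta h y - even_theta h x * odd_theta h y"
proof -
  have h: "0 < h" and yh: "y \<le> h" using assms by auto
  let ?f = "\<lambda>(m, n). jtp_exp h (x + y) m + jtp_exp h (x - y) n"
  let ?s = "\<lambda>(m, n). alt_sign m * alt_sign n"
  \<comment> \<open>\<open>?r1\<close> covers the pairs of equal parity (sign 1), \<open>?r2\<close>
    those of opposite parity (sign -1). With s = m + n - 1 and d = m - n the exponent is (h s^2 / 2
    + x s) + (h d^2 / 2 + y d) + x - h / 2. Adding h - x leaves the h / 2 built into
    \<open>odd_exp\<close>; s is odd and d even on \<open>?r1\<close>, and conversely on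
    \<open>?r2\<close>.\<close>
  let ?r1 = "\<lambda>(i, j). (i + j + 1, i - j + 1) :: int \<times> int"
  let ?r2 = "\<lambda>(i, j). (i + j + 1, i - j) :: int \<times> int"
  have adm1: "admissible UNIV (jtp_exp h a)" if "0 < a" "a < 2 * h" for a
    using abs_le_jtp_exp[OF that] by (intro admissible_abs[of _ 0]) (auto intro: order_trans[OF abs_ge_zero])
  have adm: "admissible UNIV (jtp_exp h (x + y))" "admissible UNIV (jtp_exp h (x - y))"
    using assms by (auto intro!: adm1)
  have adm2: "admissible (range ?r1 \<union> range ?r2) ?f"
    using admissible_Times[OF adm] by (auto simp: admissible_def intro: finite_subset)
  have inj: "inj ?r1" "inj ?r2"
    by (auto simp: inj_on_def)
  have disj: "range ?r1 \<inter> range ?r2 = {}"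
  proof -
    have False if "i + j + 1 = i' + j' + 1" "i - j + 1 = i' - j'" for i j i' j' :: int
      using that by presburger
    thus ?thesis by auto
  qed
  have cover: "range ?r1 \<union> range ?r2 = UNIV"
  proof -
    have "(m, n) \<in> range ?r1 \<union> range ?r2" for m n :: int
    proof (cases "even (m + n)")
      case True
      hence "(m, n) = ?r1 ((m + n) div 2 - 1, m - (m + n) div 2)"
        by auto
      thus ?thesis by blast
    next
      case False
      hence "(m, n) = ?r2 ((m + n - 1) div 2, m - 1 - (m + n - 1) div 2)"
        by (auto elim!: oddE)
      thus ?thesis by blast
    qed
    thus ?thesis by auto
  qed
  have nonneg: "0 \<le> ?f p" for p
    using admissible_Times[OF adm] by (cases p) (auto simp: admissible_def)
  have "(theta_fps h (x + y) * base_fps h) * (theta_fps h (x - y) * base_fps h) = gsum UNIV ?s ?f"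
    using assms by (simp add: jacobi_triple_product gsum_mult adm)
  also have "\<dots> = gsum (range ?r1) ?s ?f + gsum (range ?r2) ?s ?f"
    using gsum_Un_disjoint[OF adm2 disj, of ?s] by (simp add: cover)
  also have "gsum (range ?r1) ?s ?f = gsum UNIV (\<lambda>_. 1) (\<lambda>p. ?f (?r1 p))"
    by (rule gsum_reindex[OF inj(1)]) (auto simp: alt_sign_def split: prod.splits)
  also have "gsum (range ?r2) ?s ?f = gsum UNIV (\<lambda>_. -1) (\<lambda>p. ?f (?r2 p))"
    by (rule gsum_reindex[OF inj(2)]) (auto simp: alt_sign_def split: prod.splits)
  also have "\<dots> = - gsum UNIV (\<lambda>_. 1) (\<lambda>p. ?f (?r2 p))"
    by (rule gsum_uminus)
  finally have "fps_X ^ (h - x) * ((theta_fps h (x + y) * base_fps h) * (theta_fps h (x - y) * base_fps h)) =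
      fps_X ^ (h - x) * gsum UNIV (\<lambda>_. 1) (\<lambda>p. ?f (?r1 p)) - fps_X ^ (h - x) * gsum UNIV (\<lambda>_. 1) (\<lambda>p. ?f (?r2 p))"
    by (simp only: right_diff_distrib diff_conv_add_uminus[symmetric])
  also have "fps_X ^ (h - x) * gsum UNIV (\<lambda>_. 1) (\<lambda>p. ?f (?r1 p)) =
      gsum UNIV (\<lambda>_. 1) (\<lambda>p. ?f (?r1 p) + int (h - x))"
    using nonneg by (intro X_power_mult_gsum) blast
  also have "(\<lambda>p. ?f (?r1 p) + int (h - x)) = (\<lambda>(i, j). odd_exp h x i + even_exp h y j)"
    using assms by (auto simp: fun_eq_iff jtp_exp_def odd_exp_def even_exp_def of_nat_diff
      power2_eq_square algebra_simps)
  also have "gsum UNIV (\<lambda>_. 1) (\<lambda>(i, j). odd_exp h x i + even_exp h y j) = odd_theta h x * even_theta h y"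
    using gsum_mult[OF admissible_odd_exp[OF h assms(2)] admissible_even_exp[OF h yh], of "\<lambda>_. 1" "\<lambda>_. 1"]
    by (simp add: odd_theta_def even_theta_def case_prod_unfold)
  also have "fps_X ^ (h - x) * gsum UNIV (\<lambda>_. 1) (\<lambda>p. ?f (?r2 p)) =
      gsum UNIV (\<lambda>_. 1) (\<lambda>p. ?f (?r2 p) + int (h - x))"
    using nonneg by (intro X_power_mult_gsum) blast
  also have "(\<lambda>p. ?f (?r2 p) + int (h - x)) = (\<lambda>(i, j). even_exp h x i + odd_exp h y j)"
    using assms by (auto simp: fun_eq_iff jtp_exp_def odd_exp_def even_exp_def of_nat_diff
      power2_eq_square algebra_simps)
  also have "gsum UNIV (\<lambda>_. 1) (\<lambda>(i, j). even_exp h x i + odd_exp h y j) = even_theta h x * odd_theta h y"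
    using gsum_mult[OF admissible_even_exp[OF h assms(2)] admissible_odd_exp[OF h yh], of "\<lambda>_. 1" "\<lambda>_. 1"]
    by (simp add: odd_theta_def even_theta_def case_prod_unfold)
  finally show ?thesis by (simp only: mult.assoc)
qed

theorem weierstrass_three_term:
  assumes "v < y" "y < u" "u < x" "x \<le> h"
  shows "theta_fps h (x + y) * theta_fps h (x - y) * theta_fps h (u + v) * theta_fps h (u - v)
       - theta_fps h (x + v) * theta_fps h (x - v) * theta_fps h (u + y) * theta_fps h (u - y)
       = fps_X ^ (u - y) *
         (theta_fps h (x + u) * theta_fps h (x - u) * theta_fps h (y + v) * theta_fps h (y - v))"
    (is "?L = fps_X ^ (u - y) * ?R")
proof -
  let ?c = "fps_X ^ (h - x) * fps_X ^ (h - u) * base_fps h ^ 4"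
  define D where "D = (\<lambda>x y. fps_X ^ (h - x) *
    (theta_fps h (x + y) * base_fps h) * (theta_fps h (x - y) * base_fps h))"
  have D: "D a b = odd_theta h a * even_theta h b - even_theta h a * odd_theta h b"
    if "b < a" "a \<le> h" for a b
    unfolding D_def using that by (rule theta_mult_theta)
  \<comment> \<open>The order v < y < u < x makes every pair occurring here satisfy the conditions
    for writing D as a minor.\<close>
  have plucker: "D x y * D u v - D x v * D u y = D x u * D y v"
    using assms by (simp add: D algebra_simps)
  \<comment> \<open>Both products on the left carry the prefactors of x and u, the one on the right
    those of x and y; the quotient is the monomial in the claim.\<close>
  have "h - y = (h - u) + (u - y)" using assms by simp
  hence X: "fps_X ^ (h - y) = fps_X ^ (h - u) * (fps_X ^ (u - y) :: int fps)"
    by (simp only: power_add)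
  have "?c * ?L = D x y * D u v - D x v * D u y"
    by (simp add: D_def eval_nat_numeral right_diff_distrib mult_ac)
  also have "\<dots> = D x u * D y v"
    by (rule plucker)
  also have "\<dots> = ?c * (fps_X ^ (u - y) * ?R)"
    unfolding D_def X by (simp add: eval_nat_numeral mult_ac)
  finally show ?thesis
    by (simp add: base_fps_def euler_prod_nonzero)
qed

section \<open>Specialisation to modulus 30\<close>

lemma theta_fps_reflect: "a \<le> 2 * h \<Longrightarrow> theta_fps h (2 * h - a) = theta_fps h a"
  by (simp add: theta_fps_def theta_exp_def[abs_def] add.commute)

text \<open>Since x = h = 15, the arguments x + b and x - b are reflections of each other, which
  produces the squares: 24 ~ 6, 18 ~ 12 and 25 ~ 5. Also 19 ~ 11, and u - y = 1 gives the single
  factor \<open>fps_X\<close>.\<close>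

lemma theta_identity_30:
  "theta_fps 15 6 ^ 2 * theta_fps 15 7 * theta_fps 15 13
   - theta_fps 15 1 * theta_fps 15 11 * theta_fps 15 12 ^ 2
   = fps_X * (theta_fps 15 5 ^ 2 * theta_fps 15 6 * theta_fps 15 12)"
  using weierstrass_three_term[of 3 9 10 15 15]
    theta_fps_reflect[of 6 15] theta_fps_reflect[of 12 15] theta_fps_reflect[of 11 15]
    theta_fps_reflect[of 5 15]
  by (simp add: power2_eq_square mult_ac)

text \<open>Splitting a colour function into \<open>theta_exp\<close> summands factors the
  denominator of its generating function into theta products. The classes are distinct modulo 30 and
  none is 0 or 15, so the multiplicities simply add.\<close>

lemma colours_p1:
  "colours {1, 5, 11, 12} {5, 12} =
   (\<lambda>m. theta_exp 15 1 m + 2 * theta_exp 15 5 m + theta_exp 15 11 m + 2 * theta_exp 15 12 m)"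
  by (auto simp: fun_eq_iff colours_def pm30_def theta_exp_def)

lemma colours_p2:
  "colours {5, 6, 7, 13} {5, 6} =
   (\<lambda>m. 2 * theta_exp 15 5 m + 2 * theta_exp 15 6 m + theta_exp 15 7 m + theta_exp 15 13 m)"
  by (auto simp: fun_eq_iff colours_def pm30_def theta_exp_def)

lemma colours_p3:
  "colours {1, 6, 7, 11, 12, 13} {} =
   (\<lambda>m. theta_exp 15 1 m + theta_exp 15 6 m + theta_exp 15 7 m + theta_exp 15 11 m
      + theta_exp 15 12 m + theta_exp 15 13 m)"
  by (auto simp: fun_eq_iff colours_def pm30_def theta_exp_def)

theorem theorem7p1:
  fixes n :: nat
  assumes "n > 0"
  shows "int (p1 n) - int (p2 n) = int (p3 (n - 1))"
proof -
  let ?k1 = "colours {1, 5, 11, 12} {5, 12}" and ?k2 = "colours {5, 6, 7, 13} {5, 6}"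
    and ?k3 = "colours {1, 6, 7, 11, 12, 13} {}"
  let ?t = "theta_fps 15"
  \<comment> \<open>The least common denominator: each theta factor has its maximal exponent among
    the three generating functions.\<close>
  define W where "W = ?t 1 * ?t 5 ^ 2 * ?t 6 ^ 2 * ?t 7 * ?t 11 * ?t 12 ^ 2 * ?t 13"
  have "W = euler_prod ?k1 * (?t 6 ^ 2 * ?t 7 * ?t 13)"
    "W = euler_prod ?k2 * (?t 1 * ?t 11 * ?t 12 ^ 2)"
    "W = euler_prod ?k3 * (?t 5 ^ 2 * ?t 6 * ?t 12)"
    unfolding colours_p1 colours_p2 colours_p3 euler_prod_add euler_prod_times2
    by (simp_all add: W_def theta_fps_def power2_eq_square mult_ac)
  hence W: "gf_coloured ?k1 * W = ?t 6 ^ 2 * ?t 7 * ?t 13"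
    "gf_coloured ?k2 * W = ?t 1 * ?t 11 * ?t 12 ^ 2"
    "gf_coloured ?k3 * W = ?t 5 ^ 2 * ?t 6 * ?t 12"
    using gf_coloured_mult_euler_prod by (metis mult.assoc mult_1)+
  have "(gf_coloured ?k1 - gf_coloured ?k2) * W = (fps_X * gf_coloured ?k3) * W"
    by (simp only: left_diff_distrib W mult.assoc[of fps_X] theta_identity_30)
  moreover have "W \<noteq> 0"
    by (simp add: W_def theta_fps_def euler_prod_nonzero)
  ultimately have "gf_coloured ?k1 - gf_coloured ?k2 = fps_X * gf_coloured ?k3"
    by simp
  hence "(gf_coloured ?k1 - gf_coloured ?k2) $ n = (fps_X * gf_coloured ?k3) $ n"
    by simp
  \<comment> \<open>For n > 0, multiplication by \<open>fps_X\<close> moves coefficient n - 1 to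
    n.\<close>
  with assms show ?thesis
    by (simp add: gf_coloured_def p1_def p2_def p3_def)
qed

end
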